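(* Let $\alpha_3,\beta_3$ be real numbers. The double inequality $$\alpha_3H(a,b)+(1-\alpha_3)C(a,b)<M(a,b)<\beta_3H(a,b)+(1-\beta_3)C(a,b)$$ holds for all $a,b>0$ with $a\neq b$ if and only if $\alpha_3\geq 1-\frac{1}{2\log(1+\sqrt{2})}=0.4327\cdots$ and $\beta_3\leq \frac{5}{12}=0.4166\cdots$.
   Context: For real numbers $a,b>0$ with $a\neq b$: the harmonic mean is $H(a,b)=\frac{2ab}{a+b}$; the contra-harmonic mean is $C(a,b)=\frac{a^2+b^2}{a+b}$; the Neuman-Sándor mean is $M(a,b)=\frac{a-b}{2\sinh^{-1}\left(\frac{a-b}{a+b}\right)}$, where $\sinh^{-1}(x)=\log(x+\sqrt{1+x^2})$ is the inverse hyperbolic sine function. Here $\log$ is the natural logarithm. *)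

theory Defs
  imports Complex_Main
begin

definition harmonic_mean :: "real \<Rightarrow> real \<Rightarrow> real" where
  "harmonic_mean a b = 2 * a * b / (a + b)"

definition contraharmonic_mean :: "real \<Rightarrow> real \<Rightarrow> real" where
  "contraharmonic_mean a b = (a\<^sup>2 + b\<^sup>2) / (a + b)"

(* Meant for a, b > 0 with a \<noteq> b; on the diagonal the quotient is 0 / 0 = 0, not the limit a.
   Over the reals, arsinh x = ln (x + sqrt (x\<^sup>2 + 1)) (fact arsinh_real_def). *)
definition neuman_sandor_mean :: "real \<Rightarrow> real \<Rightarrow> real" where
  "neuman_sandor_mean a b = (a - b) / (2 * arsinh ((a - b) / (a + b)))"

end

theory Submission
  imports Defs "HOL-Real_Asymp.Real_Asymp" "HOL-Analysis.Harmonic_Numbers"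
begin

text \<open>
  Both inequalities are homogeneous in \<open>a, b\<close>. Dividing by the arithmetic mean
  \<open>(a + b) / 2\<close> and writing \<open>x = (a - b) / (a + b)\<close>, a number with \<open>0 < \<bar>x\<bar> < 1\<close>,
  turns the three means into \<open>1 - x\<^sup>2\<close>, \<open>1 + x\<^sup>2\<close> and \<open>x / arsinh x\<close>. All of these are even
  in \<open>x\<close>, so the double inequality says exactly that
  \<open>1 + (1 - 2 \<alpha>) x\<^sup>2 < x / arsinh x < 1 + (1 - 2 \<beta>) x\<^sup>2\<close> for \<open>0 < x < 1\<close>
  (\<open>means_bounds_iff\<close>).

  The bounds on \<open>\<alpha>\<close> and \<open>\<beta>\<close> are necessary because of the two ends of the interval: letting
  \<open>x\<close> tend to \<open>1\<close> on the left gives \<open>2 - 2 \<alpha> \<le> 1 / arsinh 1\<close>, where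
  \<open>arsinh 1 = ln (1 + sqrt 2)\<close>, while \<open>(x / arsinh x - 1) / x\<^sup>2\<close> tends to \<open>1 / 6\<close> at \<open>0\<close>
  and this gives \<open>1 / 6 \<le> 1 - 2 \<beta>\<close>.

  For sufficiency only the extreme values of \<open>\<alpha>\<close> and \<open>\<beta>\<close> matter, since the bounds are monotone
  in these parameters. The comparison of \<open>x / arsinh x\<close> with \<open>1 + c x\<^sup>2\<close> is that of
  \<open>x / (1 + c x\<^sup>2)\<close> with \<open>arsinh x\<close>. The difference \<open>g\<close> of the latter two vanishes at \<open>0\<close>, and
  after squaring away the root in the derivative of \<open>arsinh\<close>, the sign of \<open>g'\<close> at \<open>x\<close> becomes
  that of a cubic polynomial in \<open>x\<^sup>2\<close> (\<open>gap_deriv_sign\<close>) which decreases on \<open>[0, 1]\<close> when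
  \<open>0 < c \<le> 1 / 6\<close> (\<open>gap_cubic_strict_antimono\<close>). If \<open>c = 1 / 6\<close>, the cubic starts at \<open>0\<close>, so
  \<open>g\<close> decreases and is negative. If \<open>c = 1 / arsinh 1 - 1\<close>, then \<open>g\<close> vanishes at \<open>1\<close> as well, and
  since \<open>g'\<close> changes its sign at most once, from positive to negative, \<open>g\<close> is positive between.
\<close>


section \<open>Reduction to a single variable\<close>

lemma normalized_means:
  fixes a b :: real
  assumes "a > 0" "b > 0"
  defines "x \<equiv> (a - b) / (a + b)"
  shows "t * harmonic_mean a b + (1 - t) * contraharmonic_mean a b
           = (a + b) / 2 * (1 + (1 - 2 * t) * x\<^sup>2)"
    and "neuman_sandor_mean a b = (a + b) / 2 * (x / arsinh x)"
proof -
  have s: "a + b \<noteq> 0" using assms by simp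
  then have "(a + b) * (t * harmonic_mean a b + (1 - t) * contraharmonic_mean a b)
      = t * (2 * a * b) + (1 - t) * (a\<^sup>2 + b\<^sup>2)"
    by (simp only: harmonic_mean_def contraharmonic_mean_def times_divide_eq_right
          add_divide_distrib[symmetric]) simp
  also have "\<dots> = ((a + b)\<^sup>2 + (1 - 2 * t) * (a - b)\<^sup>2) / 2"
    by (simp add: power2_eq_square field_simps)
  also have "\<dots> = (a + b) * ((a + b) / 2 * (1 + (1 - 2 * t) * x\<^sup>2))"
  proof -
    have "(a - b)\<^sup>2 = (a + b)\<^sup>2 * x\<^sup>2"
      using s by (simp add: x_def power_divide)
    then show ?thesis by (simp only:) (simp add: power2_eq_square field_simps)
  qed
  finally show "t * harmonic_mean a b + (1 - t) * contraharmonic_mean a b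
           = (a + b) / 2 * (1 + (1 - 2 * t) * x\<^sup>2)"
    using s by simp
  show "neuman_sandor_mean a b = (a + b) / 2 * (x / arsinh x)"
    using s by (simp add: neuman_sandor_mean_def x_def)
qed

lemma means_bounds_iff:
  fixes p q :: real
  shows "(\<forall>a b. a > 0 \<and> b > 0 \<and> a \<noteq> b \<longrightarrow>
            p * harmonic_mean a b + (1 - p) * contraharmonic_mean a b < neuman_sandor_mean a b \<and>
            neuman_sandor_mean a b < q * harmonic_mean a b + (1 - q) * contraharmonic_mean a b)
     \<longleftrightarrow> (\<forall>x. 0 < x \<and> x < 1 \<longrightarrow>
            1 + (1 - 2 * p) * x\<^sup>2 < x / arsinh x \<and> x / arsinh x < 1 + (1 - 2 * q) * x\<^sup>2)"
    (is "(\<forall>a b. ?D a b \<longrightarrow> ?P a b) \<longleftrightarrow> (\<forall>x. _ \<longrightarrow> ?Q x)")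
proof -
  have iff: "?P a b \<longleftrightarrow> ?Q ((a - b) / (a + b))" if "?D a b" for a b
  proof -
    have "0 < (a + b) / 2" using that by simp
    then show ?thesis
      using that by (simp only: normalized_means mult_less_cancel_left_pos)
  qed
  show ?thesis
  proof (intro iffI allI impI)
    fix x :: real
    assume P: "\<forall>a b. ?D a b \<longrightarrow> ?P a b" and x: "0 < x \<and> x < 1"
    \<comment> \<open>The pair \<open>1 + x\<close>, \<open>1 - x\<close> realizes the ratio \<open>x\<close>.\<close>
    have D: "?D (1 + x) (1 - x)" using x by simp
    have "?Q (((1 + x) - (1 - x)) / ((1 + x) + (1 - x)))"
      using P D iff[OF D] by blast
    then show "?Q x" by simp
  next
    fix a b :: real
    assume Q: "\<forall>x. 0 < x \<and> x < 1 \<longrightarrow> ?Q x" and D: "?D a b"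
    let ?x = "(a - b) / (a + b)"
    have "?Q \<bar>?x\<bar>"
    proof -
      have "0 < \<bar>?x\<bar> \<and> \<bar>?x\<bar> < 1" using D by (auto simp: field_simps abs_if)
      then show ?thesis using Q by blast
    qed
    moreover have "\<bar>?x\<bar> / arsinh \<bar>?x\<bar> = ?x / arsinh ?x"
      by (simp only: abs_if arsinh_minus_real minus_divide_divide split: if_split) simp
    ultimately have "?Q ?x" by (simp only: power2_abs)
    then show "?P a b" using iff[OF D] by blast
  qed
qed


section \<open>The gap between \<open>x / (1 + c x\<^sup>2)\<close> and \<open>arsinh x\<close>\<close>

definition gap :: "real \<Rightarrow> real \<Rightarrow> real" where
  "gap c x = x / (1 + c * x\<^sup>2) - arsinh x"

definition gap_deriv :: "real \<Rightarrow> real \<Rightarrow> real" where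
  "gap_deriv c x = (1 - c * x\<^sup>2) / (1 + c * x\<^sup>2)\<^sup>2 - 1 / sqrt (x\<^sup>2 + 1)"

text \<open>The polynomial \<open>((1 - c u)\<^sup>2 (1 + u) - (1 + c u)\<^sup>4) / u\<close>, written out so as to make sense at
  \<open>u = 0\<close> too.\<close>

definition gap_cubic :: "real \<Rightarrow> real \<Rightarrow> real" where
  "gap_cubic c u = (1 - 6 * c) - (2 * c + 5 * c\<^sup>2) * u + c\<^sup>2 * (1 - 4 * c) * u\<^sup>2 - c ^ 4 * u ^ 3"

lemma gap_has_derivative:
  assumes "0 \<le> c"
  shows "(gap c has_real_derivative gap_deriv c x) (at x)"
proof -
  have pos: "1 + c * x\<^sup>2 > 0" using assms by (simp add: add_pos_nonneg)
  have eq: "gap c = (\<lambda>x. x / (1 + c * x\<^sup>2) - arsinh x)" by (simp add: gap_def fun_eq_iff)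
  show ?thesis
    unfolding eq gap_deriv_def using pos
    by (auto intro!: derivative_eq_intros simp: power2_eq_square algebra_simps)
qed

text \<open>Over the positive common denominator, the numerator of \<open>gap_deriv\<close> is
  \<open>(1 - c u) sqrt (u + 1) - (1 + c u)\<^sup>2\<close> with \<open>u = x\<^sup>2\<close>. Both terms are nonnegative because
  \<open>c u \<le> 1\<close>, so comparing their squares loses nothing and removes the root.\<close>

lemma gap_deriv_sign:
  assumes "0 \<le> c" "c \<le> 1 / 6" "0 < x" "x \<le> 1"
  shows "0 < gap_deriv c x \<longleftrightarrow> 0 < gap_cubic c (x\<^sup>2)"
    and "gap_deriv c x < 0 \<longleftrightarrow> gap_cubic c (x\<^sup>2) < 0"
proof -
  define u where "u = x\<^sup>2"
  have u: "0 < u" "u \<le> 1" using assms by (simp_all add: u_def power_le_one)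
  have "c * u \<le> 1 / 6 * 1" using assms u by (intro mult_mono) auto
  then have n: "0 \<le> 1 - c * u" by simp
  have d: "0 < 1 + c * u" using assms u by (simp add: add_pos_nonneg)
  let ?l = "(1 - c * u) * sqrt (u + 1)" and ?r = "(1 + c * u)\<^sup>2"
  have l0: "0 \<le> ?l" using n u by simp
  have r0: "0 \<le> ?r" by simp
  have "gap_deriv c x = (?l - ?r) / (?r * sqrt (u + 1))"
    using d u by (simp add: gap_deriv_def u_def[symmetric] diff_frac_eq)
  moreover have "0 < ?r * sqrt (u + 1)" using d u by simp
  moreover have sq: "?l\<^sup>2 - ?r\<^sup>2 = u * gap_cubic c u"
  proof -
    have "?l\<^sup>2 = (1 - c * u)\<^sup>2 * (u + 1)" using u by (simp add: power_mult_distrib)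
    then show ?thesis by (simp add: gap_cubic_def algebra_simps power_numeral_reduce)
  qed
  moreover have "0 < ?l - ?r \<longleftrightarrow> 0 < ?l\<^sup>2 - ?r\<^sup>2"
    using power2_less_imp_less[of ?r ?l] power_strict_mono[of ?r ?l 2] l0 r0 by auto
  moreover have "?l - ?r < 0 \<longleftrightarrow> ?l\<^sup>2 - ?r\<^sup>2 < 0"
    using power2_less_imp_less[of ?l ?r] power_strict_mono[of ?l ?r 2] l0 r0 by auto
  ultimately show "0 < gap_deriv c x \<longleftrightarrow> 0 < gap_cubic c (x\<^sup>2)"
    and "gap_deriv c x < 0 \<longleftrightarrow> gap_cubic c (x\<^sup>2) < 0"
    using u unfolding u_def[symmetric]
    by (simp_all only: zero_less_divide_iff divide_less_0_iff zero_less_mult_iff mult_less_0_iff)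
       auto
qed

text \<open>Of the nonconstant terms only the quadratic one can increase, with a slope of at most
  \<open>2 c\<^sup>2\<close> on \<open>[0, 1]\<close>; the linear term falls faster, at the rate \<open>2 c + 5 c\<^sup>2\<close>.\<close>

lemma gap_cubic_strict_antimono:
  assumes c: "0 < c" "c \<le> 1 / 6" and uv: "0 \<le> u" "u < v" "v \<le> 1"
  shows "gap_cubic c v < gap_cubic c u"
proof -
  have "c\<^sup>2 * (1 - 4 * c) * (u + v) \<le> c\<^sup>2 * 1 * 2"
    using c uv by (intro mult_mono) auto
  moreover have "0 \<le> c ^ 4 * (u\<^sup>2 + u * v + v\<^sup>2)" using uv by simp
  ultimately have "0 < (2 * c + 5 * c\<^sup>2) - c\<^sup>2 * (1 - 4 * c) * (u + v) + c ^ 4 * (u\<^sup>2 + u * v + v\<^sup>2)"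
    using c zero_le_power2[of c] by linarith
  then have "0 < (v - u) *
      ((2 * c + 5 * c\<^sup>2) - c\<^sup>2 * (1 - 4 * c) * (u + v) + c ^ 4 * (u\<^sup>2 + u * v + v\<^sup>2))"
    using uv by simp
  also have "\<dots> = gap_cubic c u - gap_cubic c v"
    unfolding gap_cubic_def by algebra
  finally show ?thesis by simp
qed

lemma gap_0 [simp]: "gap c 0 = 0"
  by (simp add: gap_def)

lemma gap_mvt:
  assumes "0 \<le> c" "x < y"
  obtains z where "x < z" "z < y" "gap c y - gap c x = (y - x) * gap_deriv c z"
  using MVT2[OF \<open>x < y\<close>, of "gap c" "gap_deriv c"] gap_has_derivative[OF \<open>0 \<le> c\<close>] by blast

lemma gap_neg:
  assumes "0 < x" "x < 1"
  shows "gap (1 / 6) x < 0"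
proof -
  obtain z where z: "0 < z" "z < x" "gap (1 / 6) x - gap (1 / 6) 0 = (x - 0) * gap_deriv (1 / 6) z"
    using gap_mvt[of "1 / 6" 0 x] assms by auto
  have "z\<^sup>2 \<le> 1" using z assms by (simp add: power_le_one)
  then have "gap_cubic (1 / 6) (z\<^sup>2) < gap_cubic (1 / 6) 0"
    using z by (intro gap_cubic_strict_antimono) auto
  also have "\<dots> = 0" by (simp add: gap_cubic_def)
  finally have "gap_deriv (1 / 6) z < 0"
    using gap_deriv_sign(2)[of "1 / 6" z] z assms by simp
  then show ?thesis using z assms by (simp add: mult_pos_neg)
qed

text \<open>If the gap failed to be positive at \<open>x\<close>, it would have to descend weakly somewhere before
  \<open>x\<close> and to ascend weakly somewhere after \<open>x\<close>; but its slope cannot pass from nonpositive to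
  nonnegative, since the cubic decreases.\<close>

lemma gap_pos:
  assumes c: "0 < c" "c \<le> 1 / 6" and end1: "gap c 1 = 0" and x: "0 < x" "x < 1"
  shows "0 < gap c x"
proof (rule ccontr)
  assume neg: "\<not> 0 < gap c x"
  obtain y where y: "0 < y" "y < x" "gap c x - gap c 0 = (x - 0) * gap_deriv c y"
    using gap_mvt[of c 0 x] c x by auto
  obtain z where z: "x < z" "z < 1" "gap c 1 - gap c x = (1 - x) * gap_deriv c z"
    using gap_mvt[of c x 1] c x by auto
  have "\<not> 0 < gap_deriv c y"
    using y x neg by (auto dest: mult_pos_pos[of x])
  then have 1: "\<not> 0 < gap_cubic c (y\<^sup>2)"
    using gap_deriv_sign(1)[of c y] c x y by simp
  have "\<not> gap_deriv c z < 0"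
    using z x neg end1 mult_pos_neg[of "1 - x" "gap_deriv c z"] by auto
  then have 2: "\<not> gap_cubic c (z\<^sup>2) < 0"
    using gap_deriv_sign(2)[of c z] c x z by simp
  have "y\<^sup>2 < z\<^sup>2" using x y z by (intro power_strict_mono) auto
  moreover have "z\<^sup>2 \<le> 1" using x z by (simp add: power_le_one)
  ultimately have "gap_cubic c (z\<^sup>2) < gap_cubic c (y\<^sup>2)"
    using c by (intro gap_cubic_strict_antimono) auto
  then show False using 1 2 by simp
qed

lemma gap_sign_iff:
  assumes "0 \<le> c" "0 < x"
  shows "0 < gap c x \<longleftrightarrow> 1 + c * x\<^sup>2 < x / arsinh x"
    and "gap c x < 0 \<longleftrightarrow> x / arsinh x < 1 + c * x\<^sup>2"
proof -
  have "0 < 1 + c * x\<^sup>2" "0 < arsinh x" using assms by (simp_all add: add_pos_nonneg)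
  then show "0 < gap c x \<longleftrightarrow> 1 + c * x\<^sup>2 < x / arsinh x"
    and "gap c x < 0 \<longleftrightarrow> x / arsinh x < 1 + c * x\<^sup>2"
    by (simp_all add: gap_def pos_less_divide_eq pos_divide_less_eq mult.commute)
qed


section \<open>The constant \<open>ln (1 + sqrt 2)\<close>\<close>

lemma arsinh_1: "arsinh (1::real) = ln (1 + sqrt 2)"
  by (simp add: arsinh_real_def)

text \<open>The numerators and denominators come from convergents of the continued fraction of
  \<open>sqrt 2\<close>, namely \<open>1393 / 985 < sqrt 2 < 99 / 70\<close>; six terms of the series of
  \<open>ln ((1 + y) / (1 - y))\<close> are precise enough.\<close>

lemma ln_1_plus_sqrt2_bounds:
  "1 / (2 * 0.5673) \<le> ln (1 + sqrt (2::real))" "ln (1 + sqrt (2::real)) < 1 / (2 * 0.5672)"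
proof -
  have "1393 / 985 \<le> sqrt (2::real)" by (rule real_le_rsqrt) (simp add: power2_eq_square)
  then have "ln (2378 / 985) \<le> ln (1 + sqrt (2::real))" by simp
  moreover have "1 / (2 * 0.5673) \<le> ln (2378 / 985 :: real)"
    using ln_approx_bounds[of "2378 / 985" 6] by (simp add: eval_nat_numeral)
  ultimately show "1 / (2 * 0.5673) \<le> ln (1 + sqrt (2::real))" by linarith
  have "sqrt (2::real) \<le> 99 / 70" by (rule real_le_lsqrt) (simp_all add: power2_eq_square)
  then have "ln (1 + sqrt (2::real)) \<le> ln (169 / 70)" by (simp add: add_pos_nonneg)
  moreover have "ln (169 / 70 :: real) < 1 / (2 * 0.5672)"
    using ln_approx_bounds[of "169 / 70" 6] by (simp add: eval_nat_numeral)
  ultimately show "ln (1 + sqrt (2::real)) < 1 / (2 * 0.5672)" by linarith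
qed

lemma critical_value_bounds:
  "0.4327 \<le> 1 - 1 / (2 * ln (1 + sqrt (2::real)))" "1 - 1 / (2 * ln (1 + sqrt (2::real))) < 0.4328"
proof -
  have "0 < ln (1 + sqrt (2::real))" using ln_1_plus_sqrt2_bounds(1) by simp
  then show "0.4327 \<le> 1 - 1 / (2 * ln (1 + sqrt (2::real)))"
    and "1 - 1 / (2 * ln (1 + sqrt (2::real))) < 0.4328"
    using ln_1_plus_sqrt2_bounds by (simp_all add: field_simps)
qed


section \<open>Sharp bounds in the normalized variable\<close>

lemma lower_bound_iff:
  fixes p :: real
  shows "(\<forall>x. 0 < x \<and> x < 1 \<longrightarrow> 1 + (1 - 2 * p) * x\<^sup>2 < x / arsinh x)
     \<longleftrightarrow> 1 - 1 / (2 * ln (1 + sqrt 2)) \<le> p"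
proof (intro iffI allI impI)
  assume *: "\<forall>x. 0 < x \<and> x < 1 \<longrightarrow> 1 + (1 - 2 * p) * x\<^sup>2 < x / arsinh x"
  have "((\<lambda>x. x / arsinh x) \<longlongrightarrow> 1 / arsinh 1) (at_left (1::real))"
    by (intro tendsto_intros) simp
  moreover have "((\<lambda>x. 1 + (1 - 2 * p) * x\<^sup>2) \<longlongrightarrow> 1 + (1 - 2 * p) * 1\<^sup>2) (at_left (1::real))"
    by (intro tendsto_intros)
  moreover have "\<forall>\<^sub>F x in at_left (1::real). 1 + (1 - 2 * p) * x\<^sup>2 \<le> x / arsinh x"
    using eventually_at_left_real[OF zero_less_one]
    by (rule eventually_mono) (use * in \<open>simp add: less_imp_le\<close>)
  ultimately have "1 + (1 - 2 * p) * 1\<^sup>2 \<le> 1 / arsinh 1"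
    by (intro tendsto_le) auto
  then show "1 - 1 / (2 * ln (1 + sqrt 2)) \<le> p" by (simp add: arsinh_1)
next
  fix x :: real
  assume p: "1 - 1 / (2 * ln (1 + sqrt 2)) \<le> p" and x: "0 < x \<and> x < 1"
  \<comment> \<open>The value of \<open>c\<close> for which \<open>1 + c x\<^sup>2\<close> and \<open>x / arsinh x\<close> agree at \<open>x = 1\<close>.\<close>
  define c where "c = 1 / ln (1 + sqrt 2) - (1::real)"
  have c: "0 < c" "c \<le> 1 / 6" using critical_value_bounds by (simp_all add: c_def)
  have "gap c 1 = 0" by (simp add: gap_def c_def arsinh_1)
  then have "1 + c * x\<^sup>2 < x / arsinh x"
    using gap_pos[of c x] gap_sign_iff(1)[of c x] c x by simp
  moreover have "(1 - 2 * p) * x\<^sup>2 \<le> c * x\<^sup>2"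
    using p by (intro mult_right_mono) (simp_all add: c_def)
  ultimately show "1 + (1 - 2 * p) * x\<^sup>2 < x / arsinh x" by linarith
qed

lemma upper_bound_iff:
  fixes q :: real
  shows "(\<forall>x. 0 < x \<and> x < 1 \<longrightarrow> x / arsinh x < 1 + (1 - 2 * q) * x\<^sup>2) \<longleftrightarrow> q \<le> 5 / 12"
proof (intro iffI allI impI)
  assume *: "\<forall>x. 0 < x \<and> x < 1 \<longrightarrow> x / arsinh x < 1 + (1 - 2 * q) * x\<^sup>2"
  have "((\<lambda>x::real. (x / arsinh x - 1) / x\<^sup>2) \<longlongrightarrow> 1 / 6) (at_right 0)"
    unfolding arsinh_real_def by real_asymp
  moreover have "(x / arsinh x - 1) / x\<^sup>2 \<le> 1 - 2 * q" if "0 < x" "x < 1" for x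
  proof -
    have "x / arsinh x < 1 + (1 - 2 * q) * x\<^sup>2" using * that by blast
    then show ?thesis using that by (simp add: pos_divide_le_eq)
  qed
  then have "\<forall>\<^sub>F x in at_right (0::real). (x / arsinh x - 1) / x\<^sup>2 \<le> 1 - 2 * q"
    using eventually_at_right_real[of 0 "1::real"] by (auto elim: eventually_mono)
  ultimately have "1 / 6 \<le> 1 - 2 * q"
    by (rule tendsto_upperbound) simp
  then show "q \<le> 5 / 12" by simp
next
  fix x :: real
  assume q: "q \<le> 5 / 12" and x: "0 < x \<and> x < 1"
  have "x / arsinh x < 1 + 1 / 6 * x\<^sup>2"
    using gap_neg[of x] gap_sign_iff(2)[of "1 / 6" x] x by simp
  moreover have "1 / 6 * x\<^sup>2 \<le> (1 - 2 * q) * x\<^sup>2"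
    using q by (intro mult_right_mono) simp_all
  ultimately show "x / arsinh x < 1 + (1 - 2 * q) * x\<^sup>2" by linarith
qed

theorem theorem1p3:
  fixes \<alpha>\<^sub>3 \<beta>\<^sub>3 :: real
  shows "((\<forall>a b :: real. a > 0 \<and> b > 0 \<and> a \<noteq> b \<longrightarrow>
            \<alpha>\<^sub>3 * harmonic_mean a b + (1 - \<alpha>\<^sub>3) * contraharmonic_mean a b < neuman_sandor_mean a b \<and>
            neuman_sandor_mean a b < \<beta>\<^sub>3 * harmonic_mean a b + (1 - \<beta>\<^sub>3) * contraharmonic_mean a b)
          \<longleftrightarrow> \<alpha>\<^sub>3 \<ge> 1 - 1 / (2 * ln (1 + sqrt 2)) \<and> \<beta>\<^sub>3 \<le> 5 / 12)
         \<and> (0.4327 \<le> (1 - 1 / (2 * ln (1 + sqrt 2)) :: real) \<and> 1 - 1 / (2 * ln (1 + sqrt 2)) < (0.4328 :: real))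
         \<and> (0.4166 \<le> (5 / 12 :: real) \<and> 5 / 12 < (0.4167 :: real))"
proof (intro conjI)
  show "(\<forall>a b :: real. a > 0 \<and> b > 0 \<and> a \<noteq> b \<longrightarrow>
            \<alpha>\<^sub>3 * harmonic_mean a b + (1 - \<alpha>\<^sub>3) * contraharmonic_mean a b < neuman_sandor_mean a b \<and>
            neuman_sandor_mean a b < \<beta>\<^sub>3 * harmonic_mean a b + (1 - \<beta>\<^sub>3) * contraharmonic_mean a b)
          \<longleftrightarrow> \<alpha>\<^sub>3 \<ge> 1 - 1 / (2 * ln (1 + sqrt 2)) \<and> \<beta>\<^sub>3 \<le> 5 / 12"
    unfolding means_bounds_iff lower_bound_iff[symmetric] upper_bound_iff[symmetric] by blast
qed (use critical_value_bounds in simp_all)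

end
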